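(* For every bidding game $\langle G,\varepsilon\rangle$, the set $\Gamma^*(G,\varepsilon)$ of its pure subgame-perfect equilibria, partially ordered by $\pi$, is a meet-semilattice.
   Context: A (two-player, impartial) game structure is $G=\langle S,s_0,T,g,u_1,u_2\rangle$ with a finite set of states $S$, initial state $s_0\in S$, terminals $T\subseteq S$, a move function $g$ assigning to each $s\in S\setminus T$ a nonempty set $g(s)\subseteq S$ of next states available to both players (no directed cycles), and utilities $u_i:T\to\mathbb R$. Preferences: $t\succ_i t'$ iff $u_i(t)>u_i(t')$, or $u_i(t)=u_i(t')$ and $u_{-i}(t)>u_{-i}(t')$, where $-i$ is the other player. Terminals with the same pair of utilities are regarded as the same outcome, so each $\succ_i$ is a strict linear order on outcomes. Bidding game $\langle G,\varepsilon\rangle$, $\varepsilon=1/R'$ with $R'$ a positive integer: budgets and bids are in $\mathcal B_\varepsilon=\{0,\varepsilon,\dots,1\}$; a budget partition $(B_1,B_2)$, $B_1+B_2=1$, is identified with $B_1$. At $s\in S\setminus T$ with budgets $(B_1,B_2)$ each player $i$ simultaneously submits a bid $b_i\le B_i$ and a next state $s_i^*\in g(s)$. The higher bidder wins (ties won by player 1, "white"; player 2 is "black"), pays her bid to the other player, and the game moves to the winner's selected state with the updated budgets. A strategy profile $\gamma$ specifies bids and next states for all $s\in S\setminus T$ and $B_1\in\mathcal B_\varepsilon$. It is a PSPE if for every $(s,B_1)$ each player best-responds to the other (with respect to $\succ_i$ on the terminal reached) in the subgame from $(s,B_1)$. The order $\pi$: it compares only bids (next-state selections are ignored, so equilibria having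 the same bids at all $(s,B_1)$ are identified). (1) For fixed $(s,B_1)$, let $(b_1,b_2)$, $(b_1',b_2')$ be the bids in $\gamma,\gamma'$. Then $\gamma'(s,B_1)>_\pi\gamma(s,B_1)$ if either (i) $\max\{b_1',b_2'\}>\max\{b_1,b_2\}$; or (ii) the winning (higher) bids are equal and the losing bid in $\gamma'$ is lower than in $\gamma$; or (iii) $b_1'=b_2>b_1=b_2'$. (2) For $s\in S\setminus T$, $\gamma'_s>_\pi\gamma_s$ if $\gamma'(s,B_1)\ge_\pi\gamma(s,B_1)$ for all $B_1\in\mathcal B_\varepsilon$ with at least one strict inequality. (3) Define $\sigma(s)$ recursively: $\gamma'=_{\sigma(t)}\gamma$ for all $t\in T$; and for $s\in S\setminus T$, $\gamma'>_{\sigma(s)}\gamma$ if both: $\gamma'\ge_{\sigma(s')}\gamma$ for all $s'\in g(s)$; and either $\gamma'>_{\sigma(s')}\gamma$ for some $s'\in g(s)$, or $\gamma'_s>_\pi\gamma_s$. (Equality $=_{\sigma(s)}$ means equal bids at all states of the subgame rooted at $s$.) (4) $\gamma'>_\pi\gamma$ if $\gamma'>_{\sigma(s_0)}\gamma$. A meet-semilattice is a partially ordered set in which any two elements have a greatest lower bound. *)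

theory Defs
  imports Complex_Main "HOL-Algebra.Lattice"
begin

datatype player = White | Black

fun opponent :: "player \<Rightarrow> player" where
  "opponent White = Black"
| "opponent Black = White"

record 's game =
  states :: "'s set"
  start :: 's
  terminals :: "'s set"
  moves :: "'s \<Rightarrow> 's set"
  util :: "player \<Rightarrow> 's \<Rightarrow> real"

definition positions :: "'s game \<Rightarrow> 's set" where
  "positions G = states G - terminals G"

definition edges :: "'s game \<Rightarrow> ('s \<times> 's) set" where
  "edges G = {(s, s'). s \<in> positions G \<and> s' \<in> moves G s}"

definition game_structure :: "'s game \<Rightarrow> bool" where
  "game_structure G \<longleftrightarrow>
     finite (states G) \<and> start G \<in> states G \<and> terminals G \<subseteq> states G \<and>
     (\<forall>s\<in>positions G. moves G s \<noteq> {} \<and> moves G s \<subseteq> states G) \<and>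
     acyclic (edges G)"

definition prefers :: "'s game \<Rightarrow> player \<Rightarrow> 's \<Rightarrow> 's \<Rightarrow> bool" where
  "prefers G i t t' \<longleftrightarrow>
     util G i t > util G i t' \<or>
     util G i t = util G i t' \<and> util G (opponent i) t > util G (opponent i) t'"

definition bidding_game :: "'s game \<Rightarrow> real \<Rightarrow> bool" where
  "bidding_game G \<epsilon> \<longleftrightarrow> game_structure G \<and> (\<exists>R::nat. R > 0 \<and> \<epsilon> = 1 / real R)"

definition budgets :: "real \<Rightarrow> real set" where
  "budgets \<epsilon> = {real k * \<epsilon> | k. real k * \<epsilon> \<le> 1}"

text \<open>A budget partition is represented by White's budget throughout.\<close>

fun budget_of :: "player \<Rightarrow> real \<Rightarrow> real" where
  "budget_of White B = B"
| "budget_of Black B = 1 - B"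

text \<open>A strategy maps a state and White's budget to a bid and a selected next state.
  Its values outside non-terminal states and feasible budgets are irrelevant; none of the
  notions below depends on them.\<close>

type_synonym 's strategy = "'s \<Rightarrow> real \<Rightarrow> real \<times> 's"
type_synonym 's profile = "player \<Rightarrow> 's strategy"

definition valid_strategy :: "'s game \<Rightarrow> real \<Rightarrow> player \<Rightarrow> 's strategy \<Rightarrow> bool" where
  "valid_strategy G \<epsilon> i \<tau> \<longleftrightarrow>
     (\<forall>s\<in>positions G. \<forall>B\<in>budgets \<epsilon>.
        fst (\<tau> s B) \<in> budgets \<epsilon> \<and> fst (\<tau> s B) \<le> budget_of i B \<and> snd (\<tau> s B) \<in> moves G s)"

definition bid :: "'s profile \<Rightarrow> player \<Rightarrow> 's \<Rightarrow> real \<Rightarrow> real" where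
  "bid \<gamma> i s B = fst (\<gamma> i s B)"

definition selection :: "'s profile \<Rightarrow> player \<Rightarrow> 's \<Rightarrow> real \<Rightarrow> 's" where
  "selection \<gamma> i s B = snd (\<gamma> i s B)"

definition winner :: "'s profile \<Rightarrow> 's \<Rightarrow> real \<Rightarrow> player" where
  "winner \<gamma> s B = (if bid \<gamma> White s B \<ge> bid \<gamma> Black s B then White else Black)"

definition next_state :: "'s profile \<Rightarrow> 's \<Rightarrow> real \<Rightarrow> 's" where
  "next_state \<gamma> s B = selection \<gamma> (winner \<gamma> s B) s B"

definition next_budget :: "'s profile \<Rightarrow> 's \<Rightarrow> real \<Rightarrow> real" where
  "next_budget \<gamma> s B =
     (case winner \<gamma> s B of
        White \<Rightarrow> B - bid \<gamma> White s B
      | Black \<Rightarrow> B + bid \<gamma> Black s B)"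

inductive play_ends :: "'s game \<Rightarrow> 's profile \<Rightarrow> 's \<Rightarrow> real \<Rightarrow> 's \<Rightarrow> bool"
  for G :: "'s game" and \<gamma> :: "'s profile" where
  terminal: "t \<in> terminals G \<Longrightarrow> play_ends G \<gamma> t B t"
| move: "\<lbrakk>s \<in> positions G; play_ends G \<gamma> (next_state \<gamma> s B) (next_budget \<gamma> s B) t\<rbrakk>
         \<Longrightarrow> play_ends G \<gamma> s B t"

text \<open>For a game structure and a profile of valid strategies, play from a state with a
  feasible budget is deterministic and, by finiteness and acyclicity, ends at exactly one
  terminal.\<close>

definition outcome :: "'s game \<Rightarrow> 's profile \<Rightarrow> 's \<Rightarrow> real \<Rightarrow> 's" where
  "outcome G \<gamma> s B = (THE t. play_ends G \<gamma> s B t)"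

definition best_responds :: "'s game \<Rightarrow> real \<Rightarrow> 's profile \<Rightarrow> player \<Rightarrow> 's \<Rightarrow> real \<Rightarrow> bool" where
  "best_responds G \<epsilon> \<gamma> i s B \<longleftrightarrow>
     (\<forall>\<tau>. valid_strategy G \<epsilon> i \<tau> \<longrightarrow>
        \<not> prefers G i (outcome G (\<gamma>(i := \<tau>)) s B) (outcome G \<gamma> s B))"

definition PSPE :: "'s game \<Rightarrow> real \<Rightarrow> 's profile set" where
  "PSPE G \<epsilon> =
     {\<gamma>. (\<forall>i. valid_strategy G \<epsilon> i (\<gamma> i)) \<and>
         (\<forall>s\<in>positions G. \<forall>B\<in>budgets \<epsilon>. \<forall>i. best_responds G \<epsilon> \<gamma> i s B)}"

text \<open>Bid pairs are ordered by the first argument being greater; the first component of a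
  pair is White's bid.\<close>

definition bids_gt :: "real \<times> real \<Rightarrow> real \<times> real \<Rightarrow> bool" where
  "bids_gt = (\<lambda>(b1', b2') (b1, b2).
     max b1' b2' > max b1 b2 \<or>
     max b1' b2' = max b1 b2 \<and> min b1' b2' < min b1 b2 \<or>
     b1' = b2 \<and> b2 > b1 \<and> b1 = b2')"

definition bids :: "'s profile \<Rightarrow> 's \<Rightarrow> real \<Rightarrow> real \<times> real" where
  "bids \<gamma> s B = (bid \<gamma> White s B, bid \<gamma> Black s B)"

definition state_gt :: "real \<Rightarrow> 's profile \<Rightarrow> 's profile \<Rightarrow> 's \<Rightarrow> bool" where
  "state_gt \<epsilon> \<gamma>' \<gamma> s \<longleftrightarrow>
     (\<forall>B\<in>budgets \<epsilon>. bids_gt (bids \<gamma>' s B) (bids \<gamma> s B) \<or> bids \<gamma>' s B = bids \<gamma> s B) \<and>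
     (\<exists>B\<in>budgets \<epsilon>. bids_gt (bids \<gamma>' s B) (bids \<gamma> s B))"

definition sigma_eq :: "'s game \<Rightarrow> real \<Rightarrow> 's profile \<Rightarrow> 's profile \<Rightarrow> 's \<Rightarrow> bool" where
  "sigma_eq G \<epsilon> \<gamma>' \<gamma> s \<longleftrightarrow>
     (\<forall>r\<in>positions G. (s, r) \<in> (edges G)\<^sup>* \<longrightarrow> (\<forall>B\<in>budgets \<epsilon>. bids \<gamma>' r B = bids \<gamma> r B))"

text \<open>Since the game graph is finite and acyclic, the inductive definition is the unique
  solution of the recursion over the successors of a state; it never holds at terminals.\<close>

inductive sigma_gt :: "'s game \<Rightarrow> real \<Rightarrow> 's profile \<Rightarrow> 's profile \<Rightarrow> 's \<Rightarrow> bool"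
  for G :: "'s game" and \<epsilon> :: real and \<gamma>' \<gamma> :: "'s profile" where
  "\<lbrakk>s \<in> positions G;
    \<forall>s'\<in>moves G s. sigma_gt G \<epsilon> \<gamma>' \<gamma> s' \<or> sigma_eq G \<epsilon> \<gamma>' \<gamma> s';
    (\<exists>s'\<in>moves G s. sigma_gt G \<epsilon> \<gamma>' \<gamma> s') \<or> state_gt \<epsilon> \<gamma>' \<gamma> s\<rbrakk>
   \<Longrightarrow> sigma_gt G \<epsilon> \<gamma>' \<gamma> s"

definition pi_gt :: "'s game \<Rightarrow> real \<Rightarrow> 's profile \<Rightarrow> 's profile \<Rightarrow> bool" where
  "pi_gt G \<epsilon> \<gamma>' \<gamma> \<longleftrightarrow> sigma_gt G \<epsilon> \<gamma>' \<gamma> (start G)"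

definition pi_eq :: "'s game \<Rightarrow> real \<Rightarrow> 's profile \<Rightarrow> 's profile \<Rightarrow> bool" where
  "pi_eq G \<epsilon> \<gamma>' \<gamma> \<longleftrightarrow> sigma_eq G \<epsilon> \<gamma>' \<gamma> (start G)"

definition pi_ge :: "'s game \<Rightarrow> real \<Rightarrow> 's profile \<Rightarrow> 's profile \<Rightarrow> bool" where
  "pi_ge G \<epsilon> \<gamma>' \<gamma> \<longleftrightarrow> pi_gt G \<epsilon> \<gamma>' \<gamma> \<or> pi_eq G \<epsilon> \<gamma>' \<gamma>"

text \<open>Equilibria with the same bids are identified, so the elements of the order are
  equivalence classes. Bids are compared on the subgame rooted at the initial state, i.e. on
  every state if all states are reachable; bids at unreachable states are invisible to the
  order. The relation on classes does not depend on the representatives.\<close>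

definition same_bids :: "'s game \<Rightarrow> real \<Rightarrow> ('s profile \<times> 's profile) set" where
  "same_bids G \<epsilon> = {(\<gamma>, \<gamma>'). \<gamma> \<in> PSPE G \<epsilon> \<and> \<gamma>' \<in> PSPE G \<epsilon> \<and> pi_eq G \<epsilon> \<gamma> \<gamma>'}"

definition PSPE_order :: "'s game \<Rightarrow> real \<Rightarrow> 's profile set gorder" where
  "PSPE_order G \<epsilon> =
     \<lparr>carrier = PSPE G \<epsilon> // same_bids G \<epsilon>,
      eq = (=),
      le = (\<lambda>X Y. \<exists>\<gamma>\<in>X. \<exists>\<gamma>'\<in>Y. pi_ge G \<epsilon> \<gamma>' \<gamma>)\<rparr>"

end

theory Submission
  imports Defs
begin

text \<open>By the one-shot deviation principle a profile is subgame perfect iff at every position and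
  budget it is an equilibrium of the one-round stage game whose payoffs are the outcomes of
  continued play. Up to utilities these outcomes depend only on the bids in the subgame, and
  every stage game has an equilibrium, whatever the continuation.

  The order compares two profiles at a state only if their bids agree everywhere below it, and
  there it is a product, over the budgets, of linear orders on bid pairs. So the meet of two
  equilibria is built upwards from the terminals: at a state, if the meet constructed below it
  agrees there with both, one, or none of the two equilibria, then take at each budget the smaller
  of their bid pairs, the bid pair of the one, or the greatest equilibrium bid pair of the stage
  game.\<close>

section \<open>Maxima and preferences\<close>

lemma finite_total_preorder_has_max:
  assumes "finite A" "A \<noteq> {}"
    and total: "\<And>x y. R x y \<or> R y x"
    and trans: "\<And>x y z. R x y \<Longrightarrow> R y z \<Longrightarrow> R x z"
  shows "\<exists>m\<in>A. \<forall>x\<in>A. R x m"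
  using assms(1,2)
proof (induction A rule: finite_ne_induct)
  case (singleton x)
  then show ?case using total by blast
next
  case (insert x F)
  then obtain m where m: "m \<in> F" "\<forall>y\<in>F. R y m" by blast
  show ?case
  proof (cases "R x m")
    case True
    with m show ?thesis by blast
  next
    case False
    then have "R m x" using total by blast
    then have "\<forall>y\<in>F. R y x" using m(2) trans by blast
    then show ?thesis using total[of x x] by blast
  qed
qed

text \<open>Terminals with equal utilities count as one outcome. Equal bids determine the outcome of
  an equilibrium only up to this relation, because selections may differ.\<close>

definition same_util :: "'s game \<Rightarrow> 's \<Rightarrow> 's \<Rightarrow> bool" where
  "same_util G t t' \<longleftrightarrow> (\<forall>i. util G i t = util G i t')"

lemma same_util_refl [simp]: "same_util G t t"
  by (simp add: same_util_def)

lemma prefers_cong: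
  "same_util G t1 t1' \<Longrightarrow> same_util G t2 t2' \<Longrightarrow> prefers G i t1 t2 \<longleftrightarrow> prefers G i t1' t2'"
  by (simp add: same_util_def prefers_def)

lemma prefers_irrefl [simp]: "\<not> prefers G i t t"
  by (simp add: prefers_def)

lemma prefers_asym: "prefers G i t t' \<Longrightarrow> \<not> prefers G i t' t"
  by (auto simp: prefers_def)

text \<open>Read \<open>\<not> prefers G i t t'\<close> as "\<open>t'\<close> is weakly better for
  \<open>i\<close>": this is a total preorder, and optimality is stated in this negated form
  throughout.\<close>

lemma not_prefers_trans:
  "\<not> prefers G i t t' \<Longrightarrow> \<not> prefers G i t' t'' \<Longrightarrow> \<not> prefers G i t t''"
  unfolding prefers_def by argo

text \<open>Preference is lexicographic in the two utilities, so the indifference of a single player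
  fixes both of them.\<close>

lemma same_utilI:
  assumes "\<not> prefers G i t t'" "\<not> prefers G i t' t"
  shows "same_util G t t'"
proof -
  have i: "util G i t = util G i t'" and opp: "util G (opponent i) t = util G (opponent i) t'"
    using assms by (auto simp: prefers_def)
  have "util G j t = util G j t'" for j
    using i opp by (cases i; cases j) auto
  then show ?thesis
    by (simp add: same_util_def)
qed

lemma finite_has_preferred:
  assumes "finite A" "A \<noteq> {}"
  shows "\<exists>m\<in>A. \<forall>x\<in>A. \<not> prefers G i (f x) (f m)"
proof (rule finite_total_preorder_has_max[OF assms])
  show "\<not> prefers G i (f x) (f y) \<or> \<not> prefers G i (f y) (f x)" for x y
    using prefers_asym[of G i "f x" "f y"] by blast
  show "\<not> prefers G i (f x) (f y) \<Longrightarrow> \<not> prefers G i (f y) (f z) \<Longrightarrow> \<not> prefers G i (f x) (f z)"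
    for x y z by (rule not_prefers_trans)
qed

section \<open>The order on bid pairs\<close>

definition bids_ge :: "real \<times> real \<Rightarrow> real \<times> real \<Rightarrow> bool" where
  "bids_ge p q \<longleftrightarrow> bids_gt p q \<or> p = q"

lemma bids_gt_irrefl [simp]: "\<not> bids_gt p p"
  by (auto simp: bids_gt_def split: prod.splits)

text \<open>The order is lexicographic: higher winning bid, then lower losing bid, then White as
  the winner. Hence it is linear.\<close>

lemma bids_ge_iff:
  "bids_ge (a, b) (c, d) \<longleftrightarrow>
     max a b > max c d \<or> max a b = max c d \<and> (min a b < min c d \<or> min a b = min c d \<and> a \<ge> c)"
proof (cases "a \<le> b"; cases "c \<le> d")
qed (auto simp: bids_ge_def bids_gt_def)

lemma bids_ge_refl [simp]: "bids_ge p p"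
  by (simp add: bids_ge_def)

lemma bids_ge_total: "bids_ge p q \<or> bids_ge q p"
proof (cases p; cases q)
  fix a b c d assume "p = (a, b)" "q = (c, d)"
  then show ?thesis using less_linear[of "max a b" "max c d"] less_linear[of "min a b" "min c d"]
      linear[of a c] by (simp only: bids_ge_iff) metis
qed

lemma bids_ge_trans:
  assumes "bids_ge p q" "bids_ge q r"
  shows "bids_ge p r"
proof -
  \<comment> \<open>Lexicographic transitivity is proved with real variables in place of the maxima
    and minima, which avoids splitting on who wins.\<close>
  have lex: "M > M'' \<or> M = M'' \<and> (m < m'' \<or> m = m'' \<and> a \<ge> a'')"
    if "M > M' \<or> M = M' \<and> (m < m' \<or> m = m' \<and> a \<ge> a')"
      "M' > M'' \<or> M' = M'' \<and> (m' < m'' \<or> m' = m'' \<and> a' \<ge> a'')"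
    for M M' M'' m m' m'' a a' a'' :: real
    using that by (elim disjE conjE) simp_all
  show ?thesis
    using assms by (cases p; cases q; cases r) (simp only: bids_ge_iff, rule lex)
qed

text \<open>The three lexicographic keys, namely maximum, minimum and White's bid, determine the
  pair.\<close>

lemma bids_ge_antisym:
  assumes "bids_ge p q" "bids_ge q p"
  shows "p = q"
proof (cases p; cases q)
  fix a b c d assume p: "p = (a, b)" "q = (c, d)"
  then have "max a b = max c d" "a = c" "min a b = min c d"
    using assms less_asym[of "max a b" "max c d"] less_asym[of "min a b" "min c d"]
    by (simp_all only: bids_ge_iff) (metis order.asym antisym)+
  then show "p = q" using p by (cases "a \<le> b"; cases "c \<le> d") simp_all
qed

section \<open>The stage game at a state\<close>

definition actions :: "'s game \<Rightarrow> real \<Rightarrow> 's \<Rightarrow> real \<Rightarrow> player \<Rightarrow> (real \<times> 's) set" where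
  "actions G \<epsilon> s B i = {(b, r). b \<in> budgets \<epsilon> \<and> b \<le> budget_of i B \<and> r \<in> moves G s}"

text \<open>\<open>c r B'\<close> stands for the terminal reached by continuing from
  \<open>r\<close> with White's budget \<open>B'\<close>. Keeping it as a parameter allows the stage
  games of different profiles to be compared.\<close>

definition stage_result :: "('s \<Rightarrow> real \<Rightarrow> 's) \<Rightarrow> real \<Rightarrow> (player \<Rightarrow> real \<times> 's) \<Rightarrow> 's" where
  "stage_result c B a =
     (if fst (a Black) \<le> fst (a White) then c (snd (a White)) (B - fst (a White))
      else c (snd (a Black)) (B + fst (a Black)))"

definition stage_eq ::
  "'s game \<Rightarrow> real \<Rightarrow> ('s \<Rightarrow> real \<Rightarrow> 's) \<Rightarrow> 's \<Rightarrow> real \<Rightarrow> (player \<Rightarrow> real \<times> 's) \<Rightarrow> bool" where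
  "stage_eq G \<epsilon> c s B a \<longleftrightarrow>
     (\<forall>i. a i \<in> actions G \<epsilon> s B i) \<and>
     (\<forall>i. \<forall>x\<in>actions G \<epsilon> s B i.
        \<not> prefers G i (stage_result c B (a(i := x))) (stage_result c B a))"

definition bid_pair :: "(player \<Rightarrow> real \<times> 's) \<Rightarrow> real \<times> real" where
  "bid_pair a = (fst (a White), fst (a Black))"

lemma bids_bid_pair: "bids \<gamma> s B = bid_pair (\<lambda>i. \<gamma> i s B)"
  by (simp add: bids_def bid_def bid_pair_def)

lemma all_player: "(\<forall>i. P i) \<longleftrightarrow> P White \<and> P Black"
  by (auto intro: player.induct)

locale bidding =
  fixes G :: "'s game" and \<epsilon> :: real
  assumes bidding: "bidding_game G \<epsilon>"
begin

abbreviation "acts \<equiv> actions G \<epsilon>"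

section \<open>Finite acyclic game graphs and induction on them\<close>

lemma game_structure_facts:
  shows finite_states: "finite (states G)"
    and start_states: "start G \<in> states G"
    and moves_nonempty: "s \<in> positions G \<Longrightarrow> moves G s \<noteq> {}"
    and moves_states: "s \<in> positions G \<Longrightarrow> r \<in> moves G s \<Longrightarrow> r \<in> states G"
    and acyclic_edges: "acyclic (edges G)"
  using bidding unfolding bidding_game_def game_structure_def by blast+

lemma positions_subset: "s \<in> positions G \<Longrightarrow> s \<in> states G"
  by (simp add: positions_def)

lemma edges_iff: "(s, r) \<in> edges G \<longleftrightarrow> s \<in> positions G \<and> r \<in> moves G s"
  by (simp add: edges_def)

lemma finite_edges: "finite (edges G)"
proof (rule finite_subset)
  show "edges G \<subseteq> states G \<times> states G"
    using positions_subset moves_states by (auto simp: edges_def)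
qed (simp add: finite_states)

text \<open>The transitive closure serves the recursive construction of the meet, which refers to
  all proper descendants of a state and not just to its successors.\<close>

lemma wf_descendants: "wf (((edges G)\<^sup>+)\<inverse>)"
  using wf_trancl[OF finite_acyclic_wf_converse[OF finite_edges acyclic_edges]]
  by (simp only: trancl_converse)

lemma descend_induct [consumes 1, case_names terminal position]:
  assumes "s \<in> states G"
    and "\<And>s. s \<in> terminals G \<Longrightarrow> s \<notin> positions G \<Longrightarrow> P s"
    and "\<And>s. s \<in> positions G \<Longrightarrow> (\<And>r. r \<in> moves G s \<Longrightarrow> r \<in> states G \<and> P r) \<Longrightarrow> P s"
  shows "P s"
  using assms(1)
proof (induction s rule: wf_induct_rule[OF wf_descendants])
  case (1 s)
  show ?case
  proof (cases "s \<in> positions G")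
    case True
    have "r \<in> states G \<and> P r" if "r \<in> moves G s" for r
    proof -
      have "(s, r) \<in> (edges G)\<^sup>+" using True that by (simp add: edges_iff r_into_trancl)
      then show ?thesis using 1(1)[of r] moves_states[OF True that] by simp
    qed
    with True show ?thesis using assms(3) by blast
  next
    case False
    with 1 show ?thesis by (intro assms(2)) (auto simp: positions_def)
  qed
qed

lemma finite_moves: "s \<in> positions G \<Longrightarrow> finite (moves G s)"
  using finite_states moves_states by (meson finite_subset subsetI)

section \<open>Arithmetic on the budget grid\<close>

lemma step_size: obtains R :: nat where "R > 0" "\<epsilon> = 1 / real R"
  using bidding by (auto simp: bidding_game_def)

lemma budgets_iff: "b \<in> budgets \<epsilon> \<longleftrightarrow> b \<le> 1 \<and> (\<exists>k::nat. b = real k * \<epsilon>)"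
  by (auto simp: budgets_def)

lemma zero_budget: "0 \<in> budgets \<epsilon>"
  by (auto simp: budgets_iff)

lemma budget_nonneg: "b \<in> budgets \<epsilon> \<Longrightarrow> 0 \<le> b"
  by (rule step_size) (auto simp: budgets_def)

lemma budget_le_1: "b \<in> budgets \<epsilon> \<Longrightarrow> b \<le> 1"
  by (simp add: budgets_iff)

lemma finite_budgets: "finite (budgets \<epsilon>)"
proof -
  obtain R :: nat where R: "R > 0" "\<epsilon> = 1 / real R" by (rule step_size)
  have "real k * \<epsilon> \<le> 1 \<Longrightarrow> k \<le> R" for k
    using R by (simp add: field_simps)
  then have "budgets \<epsilon> \<subseteq> (\<lambda>k. real k * \<epsilon>) ` {..R}"
    by (auto simp: budgets_def)
  then show ?thesis by (rule finite_subset) simp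
qed

lemma budget_add: "B \<in> budgets \<epsilon> \<Longrightarrow> b \<in> budgets \<epsilon> \<Longrightarrow> B + b \<le> 1 \<Longrightarrow> B + b \<in> budgets \<epsilon>"
  unfolding budgets_iff by (metis distrib_right of_nat_add)

lemma budget_diff:
  assumes "B \<in> budgets \<epsilon>" "b \<in> budgets \<epsilon>" "b \<le> B"
  shows "B - b \<in> budgets \<epsilon>"
proof -
  obtain R :: nat where R: "R > 0" "\<epsilon> = 1 / real R" by (rule step_size)
  from assms obtain k l where kl: "B = real k * \<epsilon>" "b = real l * \<epsilon>"
    by (auto simp: budgets_iff)
  with assms R have "l \<le> k" by (simp add: field_simps)
  with kl have "B - b = real (k - l) * \<epsilon>" by (simp add: of_nat_diff algebra_simps)
  then show ?thesis
    using assms budget_nonneg[of b] budget_le_1[of B] by (fastforce simp: budgets_iff)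
qed

section \<open>Actions and single rounds\<close>

lemma finite_actions: "s \<in> positions G \<Longrightarrow> finite (acts s B i)"
  by (rule finite_subset[of _ "budgets \<epsilon> \<times> moves G s"])
    (auto simp: actions_def finite_budgets finite_moves)

lemma zero_action:
  assumes "s \<in> positions G" "B \<in> budgets \<epsilon>"
  obtains r where "(0, r) \<in> acts s B i"
  using moves_nonempty[OF assms(1)] budget_nonneg[OF assms(2)] budget_le_1[OF assms(2)]
    zero_budget by (cases i) (auto simp: actions_def)

lemma action_bid_nonneg: "x \<in> acts s B i \<Longrightarrow> 0 \<le> fst x"
  by (auto simp: actions_def budget_nonneg)

lemma White_move:
  "x \<in> acts s B White \<Longrightarrow> B \<in> budgets \<epsilon> \<Longrightarrow> snd x \<in> moves G s \<and> B - fst x \<in> budgets \<epsilon>"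
  by (auto simp: actions_def intro: budget_diff)

lemma Black_move:
  "x \<in> acts s B Black \<Longrightarrow> B \<in> budgets \<epsilon> \<Longrightarrow> snd x \<in> moves G s \<and> B + fst x \<in> budgets \<epsilon>"
  by (auto simp: actions_def intro: budget_add)

text \<open>The next state and budget depend on the actions alone, so \<open>c\<close> is quantified
  after \<open>r\<close> and \<open>B'\<close>: two continuations are then evaluated at the same
  place.\<close>

lemma stage_next:
  assumes "\<forall>i. a i \<in> acts s B i" "B \<in> budgets \<epsilon>"
  obtains r B' where "r \<in> moves G s" "B' \<in> budgets \<epsilon>" "\<And>c. stage_result c B a = c r B'"
proof (cases "fst (a Black) \<le> fst (a White)")
  case True
  moreover have "snd (a White) \<in> moves G s \<and> B - fst (a White) \<in> budgets \<epsilon>"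
    using assms by (intro White_move) auto
  ultimately show thesis
    using that[of "snd (a White)" "B - fst (a White)"] by (simp add: stage_result_def)
next
  case False
  moreover have "snd (a Black) \<in> moves G s \<and> B + fst (a Black) \<in> budgets \<epsilon>"
    using assms by (intro Black_move) auto
  ultimately show thesis
    using that[of "snd (a Black)" "B + fst (a Black)"] by (simp add: stage_result_def)
qed

text \<open>Every unilateral deviation leads to a successor with a feasible budget, where both
  continuations give equal utilities, and preferences depend on utilities only.\<close>

lemma stage_eq_cong:
  assumes "stage_eq G \<epsilon> c s B a" "B \<in> budgets \<epsilon>"
    and c: "\<And>r B'. r \<in> moves G s \<Longrightarrow> B' \<in> budgets \<epsilon> \<Longrightarrow> same_util G (c r B') (c' r B')"
  shows "stage_eq G \<epsilon> c' s B a"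
proof -
  have acts: "\<forall>i. a i \<in> acts s B i"
    using assms(1) by (simp add: stage_eq_def)
  have result: "same_util G (stage_result c B a') (stage_result c' B a')"
    if "\<forall>i. a' i \<in> acts s B i" for a'
    by (rule stage_next[OF that assms(2)]) (simp add: c)
  have "\<not> prefers G i (stage_result c' B (a(i := x))) (stage_result c' B a)"
    if "x \<in> acts s B i" for i x
  proof -
    have "\<not> prefers G i (stage_result c B (a(i := x))) (stage_result c B a)"
      using assms(1) that by (simp add: stage_eq_def)
    then show ?thesis
      using prefers_cong[OF result result] acts that by (metis fun_upd_apply)
  qed
  then show ?thesis
    using acts by (simp add: stage_eq_def)
qed

text \<open>Escalation: let White best-respond with the highest possible winning bid. If Black
  gains by outbidding her, let him do so optimally; if White then gained by outbidding in
  turn, she would best-respond with a still higher winning bid.\<close>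

lemma stage_eq_exists:
  assumes s: "s \<in> positions G" and B: "B \<in> budgets \<epsilon>"
  shows "\<exists>a. stage_eq G \<epsilon> c s B a"
proof (rule ccontr)
  assume none: "\<nexists>a. stage_eq G \<epsilon> c s B a"
  \<comment> \<open>\<open>w x\<close> is the result if White wins with \<open>x\<close>, and
    \<open>l y\<close> the result if Black wins with \<open>y\<close>: the loser's action affects
    only who wins.\<close>
  define w where "w x = c (snd x) (B - fst x)" for x
  define l where "l x = c (snd x) (B + fst x)" for x
  define prof where "prof x y = (\<lambda>i. case i of White \<Rightarrow> x | Black \<Rightarrow> y)" for x y :: "real \<times> 's"
  have upd: "(prof x y)(White := z) = prof z y" "(prof x y)(Black := z) = prof x z" for x y z
    by (auto simp: prof_def fun_eq_iff split: player.splits)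
  define res where "res x y = (if fst y \<le> fst x then w x else l y)" for x y :: "real \<times> 's"
  have result: "stage_result c B (prof x y) = res x y" for x y
    by (simp add: stage_result_def prof_def w_def l_def res_def)
  let ?W = "acts s B White" and ?Bl = "acts s B Black"
  have no_eq: False
    if "x \<in> ?W" "y \<in> ?Bl" "\<And>z. z \<in> ?W \<Longrightarrow> \<not> prefers G White (res z y) (res x y)"
      "\<And>z. z \<in> ?Bl \<Longrightarrow> \<not> prefers G Black (res x z) (res x y)" for x y
  proof -
    have "prof x y White = x" "prof x y Black = y" by (simp_all add: prof_def)
    then have "stage_eq G \<epsilon> c s B (prof x y)"
      using that unfolding stage_eq_def all_player upd result by simp
    with none show False by blast
  qed
  \<comment> \<open>White wins with \<open>x\<close> against \<open>y\<close>, and \<open>x\<close>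
    is a best response to \<open>y\<close>. The escalation maximizes her bid over all such
    \<open>x\<close>.\<close>
  define best where "best x y \<longleftrightarrow> x \<in> ?W \<and> y \<in> ?Bl \<and> fst y \<le> fst x \<and>
    (\<forall>z\<in>?W. \<not> prefers G White (res z y) (w x))" for x y
  define A where "A = {x. \<exists>y. best x y}"
  have W: "finite ?W" and Bl: "finite ?Bl"
    using s by (simp_all add: finite_actions)
  have finA: "finite A"
    by (rule finite_subset[OF _ W]) (auto simp: A_def best_def)
  \<comment> \<open>Against a bid of 0 White wins with every action, since ties are hers, so her
    favourite winning action is a best response.\<close>
  have "A \<noteq> {}"
  proof -
    obtain r where r: "(0, r) \<in> ?Bl" by (rule zero_action[OF s B])
    have "?W \<noteq> {}" using zero_action[OF s B] by blast
    then obtain x where x: "x \<in> ?W" "\<forall>z\<in>?W. \<not> prefers G White (w z) (w x)"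
      using finite_has_preferred[OF W] by blast
    moreover have "res z (0, r) = w z" if "z \<in> ?W" for z
      using action_bid_nonneg[OF that] by (simp add: res_def)
    ultimately have "best x (0, r)"
      using r action_bid_nonneg[OF x(1)] by (simp add: best_def)
    then show ?thesis unfolding A_def by blast
  qed
  then have "\<exists>x\<in>A. \<forall>z\<in>A. fst z \<le> fst x"
    by (intro finite_total_preorder_has_max[OF finA]) auto
  then obtain x y where xy: "best x y" and x_max: "\<And>z y'. best z y' \<Longrightarrow> fst z \<le> fst x"
    unfolding A_def by blast
  have x: "x \<in> ?W" and y: "y \<in> ?Bl" and res_xy: "res x y = w x"
    using xy by (simp_all add: best_def res_def)
  define over_B where "over_B = {y\<in>?Bl. fst x < fst y}"
  \<comment> \<open>If no outbid profits Black, then \<open>x\<close> and \<open>y\<close> form an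
    equilibrium: every bid of his that does not exceed White's leaves the result
    \<open>w x\<close>.\<close>
  have "\<exists>z\<in>over_B. prefers G Black (l z) (w x)"
  proof (rule ccontr)
    assume "\<not> ?thesis"
    then have *: "\<not> prefers G Black (l z) (w x)" if "z \<in> over_B" for z
      using that by blast
    have "\<not> prefers G Black (res x z) (res x y)" if "z \<in> ?Bl" for z
      using *[of z] that unfolding res_xy by (simp add: res_def over_B_def)
    moreover have "\<not> prefers G White (res z y) (res x y)" if "z \<in> ?W" for z
      using xy that unfolding res_xy by (simp add: best_def)
    ultimately show False using no_eq[OF x y] by blast
  qed
  then obtain z0 where z0: "z0 \<in> over_B" "prefers G Black (l z0) (w x)" by blast
  have "finite over_B" using Bl by (simp add: over_B_def)
  with z0(1) obtain z where z: "z \<in> over_B" "\<forall>z'\<in>over_B. \<not> prefers G Black (l z') (l z)"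
    using finite_has_preferred[of over_B G Black l] by blast
  have gain: "prefers G Black (l z) (w x)"
    using not_prefers_trans[of G Black "l z0" "l z" "w x"] z0 z(2) by blast
  have zB: "z \<in> ?Bl" and zx: "fst x < fst z" using z(1) by (simp_all add: over_B_def)
  have res_xz: "res x z = l z" using zx by (simp add: res_def)
  \<comment> \<open>Matching Black's bid suffices for White. If none of these replies profits her,
    \<open>x\<close> and \<open>z\<close> form an equilibrium: her losing bids leave
    \<open>l z\<close>, and Black would fall back to the worse \<open>w x\<close> by not
    outbidding.\<close>
  define over_W where "over_W = {x'\<in>?W. fst z \<le> fst x'}"
  have "\<exists>x'\<in>over_W. prefers G White (w x') (l z)"
  proof (rule ccontr)
    assume "\<not> ?thesis"
    then have *: "\<not> prefers G White (w x') (l z)" if "x' \<in> over_W" for x'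
      using that by blast
    have "\<not> prefers G White (res x' z) (res x z)" if "x' \<in> ?W" for x'
      using *[of x'] that unfolding res_xz by (simp add: res_def over_W_def)
    moreover have "\<not> prefers G Black (res x z') (res x z)" if "z' \<in> ?Bl" for z'
      using prefers_asym[OF gain] bspec[OF z(2), of z'] that unfolding res_xz
      by (simp add: res_def over_B_def)
    ultimately show False using no_eq[OF x zB] by blast
  qed
  then obtain x0 where x0: "x0 \<in> over_W" "prefers G White (w x0) (l z)" by blast
  have "finite over_W" using W by (simp add: over_W_def)
  with x0(1) obtain x' where x': "x' \<in> over_W" "\<forall>z'\<in>over_W. \<not> prefers G White (w z') (w x')"
    using finite_has_preferred[of over_W G White w] by blast
  have "prefers G White (w x') (l z)"
    using not_prefers_trans[of G White "w x0" "w x'" "l z"] x0 x'(2) by blast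
  then have "\<not> prefers G White (res z' z) (w x')" if "z' \<in> ?W" for z'
    using prefers_asym[of G White "w x'" "l z"] bspec[OF x'(2), of z'] that
    by (simp add: res_def over_W_def)
  \<comment> \<open>Losing replies to \<open>z\<close> yield only \<open>l z\<close>, so the optimal
    winning reply \<open>x'\<close> is a best response; its bid is at least \<open>fst z\<close>,
    which exceeds the maximal \<open>fst x\<close>.\<close>
  then have "best x' z"
    using x'(1) zB by (simp add: best_def over_W_def)
  then have "fst x' \<le> fst x" by (rule x_max)
  with x'(1) zx show False by (simp add: over_W_def)
qed

section \<open>Outcomes and one-shot deviations\<close>

lemma outcome_terminal [simp]:
  assumes "t \<in> terminals G"
  shows "outcome G \<gamma> t B = t"
  unfolding outcome_def
proof (rule the_equality)
  show "play_ends G \<gamma> t B t" using assms by (rule play_ends.terminal)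
  show "t' = t" if "play_ends G \<gamma> t B t'" for t'
    using that assms by cases (auto simp: positions_def)
qed

text \<open>Play from \<open>s\<close> and play from the next state end at the same terminals, so
  the two definite descriptions range over equivalent predicates.\<close>

lemma outcome_position:
  assumes "s \<in> positions G"
  shows "outcome G \<gamma> s B = stage_result (outcome G \<gamma>) B (\<lambda>i. \<gamma> i s B)"
proof -
  have "play_ends G \<gamma> s B t \<longleftrightarrow> play_ends G \<gamma> (next_state \<gamma> s B) (next_budget \<gamma> s B) t" for t
    using assms by (subst play_ends.simps) (auto simp: positions_def)
  then show ?thesis
    by (simp add: outcome_def stage_result_def next_state_def next_budget_def winner_def bid_def
        selection_def)
qed

definition valid_at :: "'s profile \<Rightarrow> 's \<Rightarrow> bool" where
  "valid_at \<gamma> s \<longleftrightarrow> (\<forall>B\<in>budgets \<epsilon>. \<forall>i. \<gamma> i s B \<in> acts s B i)"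

lemma valid_strategy_iff:
  "valid_strategy G \<epsilon> i \<tau> \<longleftrightarrow> (\<forall>s\<in>positions G. \<forall>B\<in>budgets \<epsilon>. \<tau> s B \<in> acts s B i)"
  by (auto simp: valid_strategy_def actions_def case_prod_unfold)

text \<open>Valid actions keep play inside the subgame at \<open>s\<close> and budgets feasible, so
  values elsewhere cannot influence the outcome.\<close>

lemma outcome_cong:
  assumes "s \<in> states G" "B \<in> budgets \<epsilon>"
    and "\<And>r. r \<in> positions G \<Longrightarrow> (s, r) \<in> (edges G)\<^sup>* \<Longrightarrow> valid_at \<gamma> r \<and> (\<forall>i. \<gamma> i r = \<gamma>' i r)"
  shows "outcome G \<gamma> s B = outcome G \<gamma>' s B"
  using assms
proof (induction s arbitrary: B rule: descend_induct)
  case (position s)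
  have here: "valid_at \<gamma> s" "\<forall>i. \<gamma> i s = \<gamma>' i s"
    using position.prems(2)[of s] position.hyps by auto
  have "\<forall>i. \<gamma> i s B \<in> acts s B i"
    using here position.prems by (simp add: valid_at_def)
  then obtain r B' where r: "r \<in> moves G s" "B' \<in> budgets \<epsilon>"
    "\<And>c. stage_result c B (\<lambda>i. \<gamma> i s B) = c r B'"
    using stage_next position.prems(1) by metis
  have "(s, r) \<in> edges G" using position.hyps r by (simp add: edges_iff)
  then have "outcome G \<gamma> r B' = outcome G \<gamma>' r B'"
    using position.IH[OF r(1)] r(2) position.prems(2) by (meson converse_rtrancl_into_rtrancl)
  with r(3) here(2) show ?case
    by (simp add: outcome_position[OF position.hyps])
qed simp

section \<open>The one-shot deviation principle\<close>

definition eq_at :: "'s profile \<Rightarrow> 's \<Rightarrow> bool" where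
  "eq_at \<gamma> s \<longleftrightarrow> (\<forall>B\<in>budgets \<epsilon>. stage_eq G \<epsilon> (outcome G \<gamma>) s B (\<lambda>i. \<gamma> i s B))"

text \<open>Subgame perfection confined to the subgame at \<open>s\<close>, expressed by stage
  equilibria: a meet under construction can satisfy it before its values elsewhere are
  known.\<close>

definition eq_below :: "'s profile \<Rightarrow> 's \<Rightarrow> bool" where
  "eq_below \<gamma> s \<longleftrightarrow> (\<forall>r\<in>positions G. (s, r) \<in> (edges G)\<^sup>* \<longrightarrow> eq_at \<gamma> r)"

lemma eq_at_valid: "eq_at \<gamma> s \<Longrightarrow> valid_at \<gamma> s"
  by (simp add: eq_at_def valid_at_def stage_eq_def)

lemma eq_belowI:
  assumes "s \<in> positions G \<Longrightarrow> eq_at \<gamma> s"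
    and "\<And>r. s \<in> positions G \<Longrightarrow> r \<in> moves G s \<Longrightarrow> eq_below \<gamma> r"
  shows "eq_below \<gamma> s"
  unfolding eq_below_def
proof (intro ballI impI)
  fix r assume "r \<in> positions G" and "(s, r) \<in> (edges G)\<^sup>*"
  from this(2,1) show "eq_at \<gamma> r"
    using assms by (cases rule: converse_rtranclE) (auto simp: edges_iff eq_below_def)
qed

lemma eq_below_move:
  "eq_below \<gamma> s \<Longrightarrow> s \<in> positions G \<Longrightarrow> r \<in> moves G s \<Longrightarrow> eq_below \<gamma> r"
  unfolding eq_below_def by (meson converse_rtrancl_into_rtrancl edges_iff)

lemma eq_below_eq_at: "eq_below \<gamma> s \<Longrightarrow> s \<in> positions G \<Longrightarrow> eq_at \<gamma> s"
  by (simp add: eq_below_def)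

text \<open>A return to \<open>s\<close> would close a directed cycle. Hence changing a profile at
  \<open>s\<close> does not disturb the subgames of its successors.\<close>

lemma not_reachable_from_move:
  "s \<in> positions G \<Longrightarrow> r \<in> moves G s \<Longrightarrow> (r, s) \<notin> (edges G)\<^sup>*"
  using acyclic_edges rtrancl_into_trancl2[of s r "edges G" s] by (auto simp: acyclic_def edges_iff)

text \<open>A deviation at one state and budget extends to a strategy changed only there. Play never
  returns to \<open>s\<close>, so the continuation is unchanged, and what the strategy gains is what
  the single action gains.\<close>

lemma PSPE_eq_at:
  assumes "\<gamma> \<in> PSPE G \<epsilon>" and s: "s \<in> positions G"
  shows "eq_at \<gamma> s"
proof -
  have strat: "valid_strategy G \<epsilon> i (\<gamma> i)" for i
    using assms(1) by (simp add: PSPE_def)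
  then have valid: "valid_at \<gamma> r" if "r \<in> positions G" for r
    using that by (simp add: valid_at_def valid_strategy_iff)
  show ?thesis
    unfolding eq_at_def stage_eq_def
  proof (intro ballI conjI allI)
    fix B i assume B: "B \<in> budgets \<epsilon>"
    show act: "\<gamma> i s B \<in> acts s B i" for i using valid[OF s] B by (simp add: valid_at_def)
    fix x assume x: "x \<in> acts s B i"
    define \<tau> where "\<tau> = (\<gamma> i)(s := (\<gamma> i s)(B := x))"
    define \<gamma>' where "\<gamma>' = \<gamma>(i := \<tau>)"
    have "valid_strategy G \<epsilon> i \<tau>"
      using strat[of i] x by (auto simp: valid_strategy_iff \<tau>_def)
    then have "\<not> prefers G i (outcome G \<gamma>' s B) (outcome G \<gamma> s B)"
      using assms B by (simp add: PSPE_def best_responds_def \<gamma>'_def)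
    moreover have "(\<lambda>j. \<gamma>' j s B) = (\<lambda>j. \<gamma> j s B)(i := x)"
      by (auto simp: \<gamma>'_def \<tau>_def)
    moreover have "stage_result (outcome G \<gamma>') B ((\<lambda>j. \<gamma> j s B)(i := x)) =
      stage_result (outcome G \<gamma>) B ((\<lambda>j. \<gamma> j s B)(i := x))"
    proof -
      have "\<forall>j. ((\<lambda>j. \<gamma> j s B)(i := x)) j \<in> acts s B j" using act x by simp
      then obtain r B' where r: "r \<in> moves G s" "B' \<in> budgets \<epsilon>"
        "\<And>c. stage_result c B ((\<lambda>j. \<gamma> j s B)(i := x)) = c r B'"
        using stage_next B by metis
      have "\<forall>j. \<gamma> j r' = \<gamma>' j r'" if "(r, r') \<in> (edges G)\<^sup>*" for r'
        using that not_reachable_from_move[OF s r(1)] by (auto simp: \<gamma>'_def \<tau>_def)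
      then have "outcome G \<gamma> r B' = outcome G \<gamma>' r B'"
        using outcome_cong[OF moves_states[OF s r(1)] r(2)] valid by blast
      with r(3) show ?thesis by simp
    qed
    ultimately show "\<not> prefers G i (stage_result (outcome G \<gamma>) B ((\<lambda>j. \<gamma> j s B)(i := x)))
        (stage_result (outcome G \<gamma>) B (\<lambda>j. \<gamma> j s B))"
      by (simp add: outcome_position[OF s])
  qed
qed

text \<open>By induction from the terminals: after its first action a deviation does no better than
  following \<open>\<gamma>\<close>, and that action followed by \<open>\<gamma>\<close> does no
  better than \<open>\<gamma>\<close> by the stage equilibrium.\<close>

lemma eq_at_PSPE:
  assumes eq: "\<And>s. s \<in> positions G \<Longrightarrow> eq_at \<gamma> s"
  shows "\<gamma> \<in> PSPE G \<epsilon>"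
proof -
  have valid: "\<gamma> i s B \<in> acts s B i" if "s \<in> positions G" "B \<in> budgets \<epsilon>" for i s B
    using eq_at_valid[OF eq] that by (simp add: valid_at_def)
  have "\<not> prefers G i (outcome G (\<gamma>(i := \<tau>)) s B) (outcome G \<gamma> s B)"
    if \<tau>: "valid_strategy G \<epsilon> i \<tau>" and "s \<in> states G" "B \<in> budgets \<epsilon>" for i \<tau> s B
    using that(2,3)
  proof (induction s arbitrary: B rule: descend_induct)
    case (position s)
    define a where "a = (\<lambda>j. \<gamma> j s B)(i := \<tau> s B)"
    have \<tau>s: "\<tau> s B \<in> acts s B i"
      using \<tau> position by (simp add: valid_strategy_iff)
    then have "\<forall>j. a j \<in> acts s B j"
      using valid position by (simp add: a_def)
    then obtain r B' where r: "r \<in> moves G s" "B' \<in> budgets \<epsilon>" "\<And>c. stage_result c B a = c r B'"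
      using stage_next position.prems(1) by metis
    have "\<not> prefers G i (outcome G (\<gamma>(i := \<tau>)) r B') (outcome G \<gamma> r B')"
      using position.IH[OF r(1)] r(2) by blast
    moreover have "\<not> prefers G i (stage_result (outcome G \<gamma>) B a) (outcome G \<gamma> s B)"
      using eq[OF position.hyps] position.prems \<tau>s
      by (simp add: eq_at_def stage_eq_def a_def outcome_position[OF position.hyps])
    moreover have "(\<lambda>j. (\<gamma>(i := \<tau>)) j s B) = a"
      by (auto simp: a_def)
    then have "outcome G (\<gamma>(i := \<tau>)) s B = outcome G (\<gamma>(i := \<tau>)) r B'"
      using r(3) by (simp add: outcome_position[OF position.hyps])
    ultimately show ?case
      using r(3) not_prefers_trans by metis
  qed simp
  then show ?thesis
    using valid positions_subset
    by (auto simp: PSPE_def best_responds_def valid_strategy_iff)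
qed

lemma PSPE_eq_below: "\<gamma> \<in> PSPE G \<epsilon> \<Longrightarrow> eq_below \<gamma> s"
  by (simp add: eq_below_def PSPE_eq_at)

section \<open>The order on profiles\<close>

abbreviation same :: "'s profile \<Rightarrow> 's profile \<Rightarrow> 's \<Rightarrow> bool" where
  "same \<equiv> sigma_eq G \<epsilon>"

definition sigma_ge :: "'s profile \<Rightarrow> 's profile \<Rightarrow> 's \<Rightarrow> bool" where
  "sigma_ge \<alpha> \<beta> s \<longleftrightarrow> sigma_gt G \<epsilon> \<alpha> \<beta> s \<or> same \<alpha> \<beta> s"

lemma same_refl [simp]: "same \<alpha> \<alpha> s"
  by (simp add: sigma_eq_def)

lemma same_sym: "same \<alpha> \<beta> s \<Longrightarrow> same \<beta> \<alpha> s"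
  by (simp add: sigma_eq_def)

lemma same_trans: "same \<alpha> \<beta> s \<Longrightarrow> same \<beta> \<gamma> s \<Longrightarrow> same \<alpha> \<gamma> s"
  by (simp add: sigma_eq_def)

lemma same_not_position:
  assumes "s \<notin> positions G"
  shows "same \<alpha> \<beta> s"
  unfolding sigma_eq_def
proof (intro ballI impI)
  fix r B assume "r \<in> positions G" "(s, r) \<in> (edges G)\<^sup>*"
  from this(2,1) assms show "bids \<alpha> r B = bids \<beta> r B"
    by (cases rule: converse_rtranclE) (auto simp: edges_iff)
qed

lemma same_position:
  assumes "s \<in> positions G"
  shows "same \<alpha> \<beta> s \<longleftrightarrow>
    (\<forall>r\<in>moves G s. same \<alpha> \<beta> r) \<and> (\<forall>B\<in>budgets \<epsilon>. bids \<alpha> s B = bids \<beta> s B)"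
proof
  assume *: "same \<alpha> \<beta> s"
  have "same \<alpha> \<beta> r" if "r \<in> moves G s" for r
    using * that assms unfolding sigma_eq_def
    by (meson converse_rtrancl_into_rtrancl edges_iff)
  with * assms show "(\<forall>r\<in>moves G s. same \<alpha> \<beta> r) \<and> (\<forall>B\<in>budgets \<epsilon>. bids \<alpha> s B = bids \<beta> s B)"
    by (simp add: sigma_eq_def)
next
  assume *: "(\<forall>r\<in>moves G s. same \<alpha> \<beta> r) \<and> (\<forall>B\<in>budgets \<epsilon>. bids \<alpha> s B = bids \<beta> s B)"
  show "same \<alpha> \<beta> s"
    unfolding sigma_eq_def
  proof (intro ballI impI)
    fix r B assume "r \<in> positions G" "B \<in> budgets \<epsilon>" and "(s, r) \<in> (edges G)\<^sup>*"
    from this(3,1,2) * show "bids \<alpha> r B = bids \<beta> r B"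
      by (cases rule: converse_rtranclE) (auto simp: edges_iff sigma_eq_def)
  qed
qed

lemma sigma_gt_not_same: "sigma_gt G \<epsilon> \<alpha> \<beta> s \<Longrightarrow> \<not> same \<alpha> \<beta> s"
proof (induction rule: sigma_gt.induct)
  case (1 s)
  then show ?case by (fastforce simp: same_position state_gt_def)
qed

lemma same_sigma_ge: "same \<alpha> \<beta> s \<Longrightarrow> sigma_ge \<alpha> \<beta> s"
  by (simp add: sigma_ge_def)

text \<open>A difference at some successor makes the bids at the state itself irrelevant.\<close>

lemma sigma_ge_position:
  assumes "s \<in> positions G"
  shows "sigma_ge \<alpha> \<beta> s \<longleftrightarrow>
    (\<forall>r\<in>moves G s. sigma_ge \<alpha> \<beta> r) \<and>
    ((\<exists>r\<in>moves G s. \<not> same \<alpha> \<beta> r) \<or> (\<forall>B\<in>budgets \<epsilon>. bids_ge (bids \<alpha> s B) (bids \<beta> s B)))"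
    (is "?L \<longleftrightarrow> ?R")
proof -
  have state_gt: "state_gt \<epsilon> \<alpha> \<beta> s \<longleftrightarrow>
    (\<forall>B\<in>budgets \<epsilon>. bids_ge (bids \<alpha> s B) (bids \<beta> s B)) \<and>
    (\<exists>B\<in>budgets \<epsilon>. bids \<alpha> s B \<noteq> bids \<beta> s B)"
    unfolding state_gt_def bids_ge_def by (metis bids_gt_irrefl)
  have gt: "sigma_gt G \<epsilon> \<alpha> \<beta> s \<longleftrightarrow> (\<forall>r\<in>moves G s. sigma_ge \<alpha> \<beta> r) \<and>
    ((\<exists>r\<in>moves G s. sigma_gt G \<epsilon> \<alpha> \<beta> r) \<or> state_gt \<epsilon> \<alpha> \<beta> s)"
    using assms by (subst sigma_gt.simps) (simp add: sigma_ge_def)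
  have strict: "sigma_gt G \<epsilon> \<alpha> \<beta> r \<longleftrightarrow> sigma_ge \<alpha> \<beta> r \<and> \<not> same \<alpha> \<beta> r" for r
    using sigma_gt_not_same by (auto simp: sigma_ge_def)
  show ?thesis
  proof
    assume ?L
    then consider "sigma_gt G \<epsilon> \<alpha> \<beta> s" | "same \<alpha> \<beta> s" by (auto simp: sigma_ge_def)
    then show ?R
      by cases (use gt strict state_gt in blast, use same_position[OF assms] same_sigma_ge in force)
  next
    assume R: ?R
    show ?L
    proof (cases "same \<alpha> \<beta> s")
      case False
      then have "sigma_gt G \<epsilon> \<alpha> \<beta> s"
        using R gt strict state_gt same_position[OF assms] by blast
      then show ?thesis by (simp add: sigma_ge_def)
    qed (rule same_sigma_ge)
  qed
qed

lemma sigma_ge_move: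
  "sigma_ge \<alpha> \<beta> s \<Longrightarrow> s \<in> positions G \<Longrightarrow> r \<in> moves G s \<Longrightarrow> sigma_ge \<alpha> \<beta> r"
  by (simp add: sigma_ge_position)

lemma sigma_ge_bids:
  assumes "sigma_ge \<alpha> \<beta> s" "s \<in> positions G" "\<And>r. r \<in> moves G s \<Longrightarrow> same \<alpha> \<beta> r" "B \<in> budgets \<epsilon>"
  shows "bids_ge (bids \<alpha> s B) (bids \<beta> s B)"
  using assms by (auto simp: sigma_ge_position)

lemma sigma_ge_antisym:
  assumes "s \<in> states G" "sigma_ge \<alpha> \<beta> s" "sigma_ge \<beta> \<alpha> s"
  shows "same \<alpha> \<beta> s"
  using assms
proof (induction s rule: descend_induct)
  case (position s)
  then have *: "same \<alpha> \<beta> r" if "r \<in> moves G s" for r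
    using that sigma_ge_move by blast
  have "bids \<alpha> s B = bids \<beta> s B" if "B \<in> budgets \<epsilon>" for B
    using sigma_ge_bids[of \<alpha> \<beta>] sigma_ge_bids[of \<beta> \<alpha>] position * that
    by (blast intro: bids_ge_antisym same_sym)
  with * show ?case by (simp add: same_position position)
qed (simp add: same_not_position)

text \<open>Bids at \<open>s\<close> matter only if \<open>\<alpha>\<close> and
  \<open>\<gamma>\<close> agree at all successors. There \<open>\<beta>\<close> is squeezed between
  them: the induction hypothesis for the triple \<open>\<beta>\<close>, \<open>\<gamma>\<close>,
  \<open>\<alpha>\<close> and antisymmetry make all three agree, so both bid comparisons at
  \<open>s\<close> are available.\<close>

lemma sigma_ge_trans:
  assumes "s \<in> states G" "sigma_ge \<alpha> \<beta> s" "sigma_ge \<beta> \<gamma> s"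
  shows "sigma_ge \<alpha> \<gamma> s"
  using assms
proof (induction s arbitrary: \<alpha> \<beta> \<gamma> rule: descend_induct)
  case (position s)
  note s = \<open>s \<in> positions G\<close>
  have ge: "sigma_ge \<alpha> \<gamma> r" if "r \<in> moves G s" for r
    using that position sigma_ge_move by blast
  have "bids_ge (bids \<alpha> s B) (bids \<gamma> s B)"
    if all: "\<forall>r\<in>moves G s. same \<alpha> \<gamma> r" and B: "B \<in> budgets \<epsilon>" for B
  proof -
    have *: "same \<alpha> \<beta> r" "same \<beta> \<gamma> r" if r: "r \<in> moves G s" for r
    proof -
      have "sigma_ge \<gamma> \<alpha> r" using all r by (blast intro: same_sigma_ge same_sym)
      moreover have "sigma_ge \<alpha> \<beta> r" "sigma_ge \<beta> \<gamma> r"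
        using position.prems s r sigma_ge_move by blast+
      ultimately have "sigma_ge \<beta> \<alpha> r" using position.IH[OF r] by blast
      then show "same \<alpha> \<beta> r"
        using sigma_ge_antisym moves_states[OF s r] \<open>sigma_ge \<alpha> \<beta> r\<close> by blast
      then show "same \<beta> \<gamma> r" using all r same_sym same_trans by blast
    qed
    show ?thesis
      using sigma_ge_bids[OF position.prems(1) s *(1) B]
        sigma_ge_bids[OF position.prems(2) s *(2) B] by (rule bids_ge_trans)
  qed
  with ge show ?case by (auto simp: sigma_ge_position[OF s])
qed (simp add: same_not_position same_sigma_ge)

text \<open>Equal bids fix the winner and the next budget, and two selections that are both optimal for
  the winner lead to outcomes with equal utilities.\<close>

lemma same_bids_same_util:
  assumes "s \<in> states G" "B \<in> budgets \<epsilon>" "eq_below \<alpha> s" "eq_below \<beta> s" "same \<alpha> \<beta> s"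
  shows "same_util G (outcome G \<alpha> s B) (outcome G \<beta> s B)"
  using assms
proof (induction s arbitrary: B rule: descend_induct)
  case (position s)
  note s = \<open>s \<in> positions G\<close>
  have IH: "same_util G (outcome G \<alpha> r B') (outcome G \<beta> r B')"
    if "r \<in> moves G s" "B' \<in> budgets \<epsilon>" for r B'
    using position that eq_below_move same_position[OF s] by blast
  have eq: "stage_eq G \<epsilon> (outcome G \<alpha>) s B (\<lambda>i. \<alpha> i s B)"
    "stage_eq G \<epsilon> (outcome G \<beta>) s B (\<lambda>i. \<beta> i s B)"
    using position.prems eq_below_eq_at[OF _ s] by (auto simp: eq_at_def)
  have b: "fst (\<alpha> White s B) = fst (\<beta> White s B)" "fst (\<alpha> Black s B) = fst (\<beta> Black s B)"
    using position.prems same_position[OF s] by (auto simp: bids_def bid_def)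
  have acts: "\<alpha> i s B \<in> acts s B i" "\<beta> i s B \<in> acts s B i" for i
    using eq by (auto simp: stage_eq_def)
  \<comment> \<open>Each player switches to the action from the other profile. As the bids coincide,
    this changes only the selection.\<close>
  have best: "\<not> prefers G i (stage_result (outcome G \<alpha>) B ((\<lambda>i. \<alpha> i s B)(i := \<beta> i s B)))
      (outcome G \<alpha> s B)"
    "\<not> prefers G i (stage_result (outcome G \<beta>) B ((\<lambda>i. \<beta> i s B)(i := \<alpha> i s B)))
      (outcome G \<beta> s B)" for i
    using eq acts by (auto simp: stage_eq_def outcome_position[OF s])
  define i where "i = (if fst (\<alpha> Black s B) \<le> fst (\<alpha> White s B) then White else Black)"
  define B' where "B' = (if fst (\<alpha> Black s B) \<le> fst (\<alpha> White s B) then B - fst (\<alpha> White s B)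
    else B + fst (\<alpha> Black s B))"
  have moves: "snd (\<alpha> i s B) \<in> moves G s" "snd (\<beta> i s B) \<in> moves G s"
    using acts[of i] by (auto simp: actions_def case_prod_unfold)
  have B': "B' \<in> budgets \<epsilon>"
    using White_move[OF acts(1)] Black_move[OF acts(1)] position.prems(1) by (simp add: B'_def)
  have "\<not> prefers G i (outcome G \<alpha> (snd (\<beta> i s B)) B') (outcome G \<alpha> s B)"
    "\<not> prefers G i (outcome G \<beta> (snd (\<alpha> i s B)) B') (outcome G \<beta> s B)"
    using best[of i] b by (auto simp: stage_result_def i_def B'_def split: if_splits)
  moreover have "outcome G \<alpha> s B = outcome G \<alpha> (snd (\<alpha> i s B)) B'"
    "outcome G \<beta> s B = outcome G \<beta> (snd (\<beta> i s B)) B'"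
    using b by (auto simp: outcome_position[OF s] stage_result_def i_def B'_def)
  \<comment> \<open>The induction hypothesis exchanges the continuations behind a fixed successor,
    turning the two optimality statements into mutual non-preference.\<close>
  ultimately have "\<not> prefers G i (outcome G \<beta> s B) (outcome G \<alpha> s B)"
    "\<not> prefers G i (outcome G \<alpha> s B) (outcome G \<beta> s B)"
    using prefers_cong[OF IH[OF moves(2) B'] same_util_refl]
      prefers_cong[OF IH[OF moves(1) B'] same_util_refl] by auto
  then show ?case by (intro same_utilI)
qed simp

section \<open>Construction of the meet\<close>

text \<open>The competing lower bounds \<open>\<delta>\<close> are equilibria of the whole game,
  whereas \<open>\<mu>\<close> need be one only below \<open>s\<close>, so that it can be built
  upwards.\<close>

definition meet_at :: "'s profile \<Rightarrow> 's profile \<Rightarrow> 's profile \<Rightarrow> 's \<Rightarrow> bool" where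
  "meet_at \<alpha> \<beta> \<mu> s \<longleftrightarrow>
     eq_below \<mu> s \<and> sigma_ge \<alpha> \<mu> s \<and> sigma_ge \<beta> \<mu> s \<and>
     (\<forall>\<delta>\<in>PSPE G \<epsilon>. sigma_ge \<alpha> \<delta> s \<longrightarrow> sigma_ge \<beta> \<delta> s \<longrightarrow> sigma_ge \<mu> \<delta> s)"

lemma eq_below_cong:
  assumes "eq_below \<mu> s" "s \<in> states G"
    and agree: "\<And>r. (s, r) \<in> (edges G)\<^sup>* \<Longrightarrow> \<forall>i. \<mu> i r = \<mu>' i r"
  shows "eq_below \<mu>' s"
  unfolding eq_below_def eq_at_def
proof (intro ballI impI)
  fix r B assume r: "r \<in> positions G" "(s, r) \<in> (edges G)\<^sup>*" and B: "B \<in> budgets \<epsilon>"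
  have eq: "stage_eq G \<epsilon> (outcome G \<mu>) r B (\<lambda>i. \<mu> i r B)"
    using assms(1) r B by (auto simp: eq_below_def eq_at_def)
  have outcomes: "outcome G \<mu> q B' = outcome G \<mu>' q B'"
    if "q \<in> moves G r" "B' \<in> budgets \<epsilon>" for q B'
  proof (rule outcome_cong)
    show "q \<in> states G" using that r by (blast intro: moves_states)
    have "(s, q) \<in> (edges G)\<^sup>*" using r that by (meson rtrancl.rtrancl_into_rtrancl edges_iff)
    then show "valid_at \<mu> p \<and> (\<forall>i. \<mu> i p = \<mu>' i p)"
      if "p \<in> positions G" "(q, p) \<in> (edges G)\<^sup>*" for p
      using that assms(1) agree eq_at_valid by (meson eq_below_def rtrancl_trans)
  qed (fact that)
  have "stage_eq G \<epsilon> (outcome G \<mu>') r B (\<lambda>i. \<mu> i r B)"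
    by (rule stage_eq_cong[OF eq B]) (simp add: outcomes)
  with agree[OF r(2)] show "stage_eq G \<epsilon> (outcome G \<mu>') r B (\<lambda>i. \<mu>' i r B)" by simp
qed

text \<open>Bids and stage equilibria in the subgame at \<open>s\<close> are determined by the
  values there, so a meet survives any change elsewhere.\<close>

lemma meet_at_cong:
  assumes "meet_at \<alpha> \<beta> \<mu> s" "s \<in> states G"
    and agree: "\<And>r. (s, r) \<in> (edges G)\<^sup>* \<Longrightarrow> \<forall>i. \<mu> i r = \<mu>' i r"
  shows "meet_at \<alpha> \<beta> \<mu>' s"
proof -
  have "same \<mu> \<mu>' s"
    using agree by (simp add: sigma_eq_def bids_bid_pair)
  then have "sigma_ge \<mu> \<mu>' s" "sigma_ge \<mu>' \<mu> s"
    by (auto intro: same_sigma_ge same_sym)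
  then have "sigma_ge \<gamma> \<mu> s \<Longrightarrow> sigma_ge \<gamma> \<mu>' s" "sigma_ge \<mu> \<gamma> s \<Longrightarrow> sigma_ge \<mu>' \<gamma> s" for \<gamma>
    using sigma_ge_trans[OF assms(2)] by blast+
  moreover have "eq_below \<mu>' s"
    using eq_below_cong[OF _ assms(2) agree] assms(1) by (simp add: meet_at_def)
  ultimately show ?thesis
    using assms(1) by (simp add: meet_at_def)
qed

text \<open>At each budget, take the greatest equilibrium bids of the stage game that do not
  exceed those of the given profiles in case these agree with the meet at all successors.\<close>

lemma meet_at_extend:
  assumes s: "s \<in> positions G" and \<alpha>: "\<alpha> \<in> PSPE G \<epsilon>" and \<beta>: "\<beta> \<in> PSPE G \<epsilon>"
    and below: "\<And>r. r \<in> moves G s \<Longrightarrow> meet_at \<alpha> \<beta> \<mu> r"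
  shows "\<exists>x. meet_at \<alpha> \<beta> (\<lambda>i. (\<mu> i)(s := x i)) s"
proof -
  define c where "c = outcome G \<mu>"
  \<comment> \<open>Only in this case does the order compare the bids of \<open>\<gamma>\<close> and
    of the meet at \<open>s\<close>, so only then do they constrain the choice in
    \<open>N\<close>.\<close>
  define E where "E \<gamma> \<longleftrightarrow> (\<forall>r\<in>moves G s. same \<gamma> \<mu> r)" for \<gamma>
  define N where "N B = {a. stage_eq G \<epsilon> c s B a \<and>
    (\<forall>\<gamma>\<in>{\<alpha>, \<beta>}. E \<gamma> \<longrightarrow> bids_ge (bids \<gamma> s B) (bid_pair a))}" for B
  \<comment> \<open>Agreeing bids below \<open>s\<close> give continuations with equal utilities, so
    the actions of \<open>\<gamma>\<close> at \<open>s\<close> are also an equilibrium for the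
    continuation \<open>c\<close>.\<close>
  have transfer: "stage_eq G \<epsilon> c s B (\<lambda>i. \<gamma> i s B)"
    if "\<gamma> \<in> PSPE G \<epsilon>" "E \<gamma>" "B \<in> budgets \<epsilon>" for \<gamma> B
  proof (rule stage_eq_cong)
    show "stage_eq G \<epsilon> (outcome G \<gamma>) s B (\<lambda>i. \<gamma> i s B)"
      using PSPE_eq_at[OF that(1) s] that(3) by (simp add: eq_at_def)
    show "same_util G (outcome G \<gamma> r B') (c r B')" if "r \<in> moves G s" "B' \<in> budgets \<epsilon>" for r B'
      unfolding c_def
      using that \<open>E \<gamma>\<close> PSPE_eq_below[OF \<open>\<gamma> \<in> PSPE G \<epsilon>\<close>] below moves_states[OF s]
      by (intro same_bids_same_util) (auto simp: E_def meet_at_def)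
  qed (fact that)
  have "\<exists>a\<in>N B. \<forall>a'\<in>N B. bids_ge (bid_pair a) (bid_pair a')" if B: "B \<in> budgets \<epsilon>" for B
  proof -
    \<comment> \<open>If \<open>E\<close> holds for \<open>\<alpha>\<close> or
      \<open>\<beta>\<close>, take the actions of that profile, with the smaller bids if it holds
      for both; otherwise the bound is vacuous and any stage equilibrium will do.\<close>
    have "N B \<noteq> {}"
    proof (cases "E \<alpha> \<or> E \<beta>")
      case False
      then show ?thesis using stage_eq_exists[OF s B, of c] by (auto simp: N_def)
    next
      case True
      then obtain \<gamma> where "\<gamma> \<in> {\<alpha>, \<beta>}" "E \<gamma>"
        "\<forall>\<gamma>'\<in>{\<alpha>, \<beta>}. E \<gamma>' \<longrightarrow> bids_ge (bids \<gamma>' s B) (bids \<gamma> s B)"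
        using bids_ge_total[of "bids \<alpha> s B" "bids \<beta> s B"] bids_ge_refl by blast
      then have "(\<lambda>i. \<gamma> i s B) \<in> N B"
        using transfer[of \<gamma> B] \<alpha> \<beta> B by (auto simp: N_def bids_bid_pair)
      then show ?thesis by blast
    qed
    moreover have "finite (bid_pair ` N B)"
      by (rule finite_subset[of _ "budgets \<epsilon> \<times> budgets \<epsilon>"])
        (auto simp: N_def stage_eq_def bid_pair_def actions_def all_player finite_budgets)
    ultimately have "\<exists>p\<in>bid_pair ` N B. \<forall>q\<in>bid_pair ` N B. bids_ge p q"
      using bids_ge_total bids_ge_trans
      by (intro finite_total_preorder_has_max[where R = "\<lambda>p q. bids_ge q p"]) blast+
    then show ?thesis by blast
  qed
  then obtain x where x: "\<And>B. B \<in> budgets \<epsilon> \<Longrightarrow> x B \<in> N B"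
    and x_max: "\<And>B a. B \<in> budgets \<epsilon> \<Longrightarrow> a \<in> N B \<Longrightarrow> bids_ge (bid_pair (x B)) (bid_pair a)"
    by metis
  define \<mu>' where "\<mu>' = (\<lambda>i. (\<mu> i)(s := \<lambda>B. x B i))"
  have agree: "\<forall>i. \<mu> i q = \<mu>' i q" if "r \<in> moves G s" "(r, q) \<in> (edges G)\<^sup>*" for r q
    using that not_reachable_from_move[OF s] by (auto simp: \<mu>'_def)
  have below': "meet_at \<alpha> \<beta> \<mu>' r" if "r \<in> moves G s" for r
    using meet_at_cong[OF below moves_states[OF s]] that agree by blast
  have same': "same \<mu> \<mu>' r" if "r \<in> moves G s" for r
    using agree[OF that] by (simp add: sigma_eq_def bids_bid_pair)
  have bids': "bids \<mu>' s B = bid_pair (x B)" for B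
    by (simp add: bids_bid_pair \<mu>'_def)
  have "stage_eq G \<epsilon> (outcome G \<mu>') s B (\<lambda>i. \<mu>' i s B)" if B: "B \<in> budgets \<epsilon>" for B
  proof (rule stage_eq_cong[OF _ B])
    show "stage_eq G \<epsilon> c s B (\<lambda>i. \<mu>' i s B)"
      using x[OF B] by (simp add: N_def \<mu>'_def)
    show "same_util G (c r B') (outcome G \<mu>' r B')" if "r \<in> moves G s" "B' \<in> budgets \<epsilon>" for r B'
      unfolding c_def using that below below' same' moves_states[OF s]
      by (intro same_bids_same_util) (auto simp: meet_at_def)
  qed
  then have "eq_at \<mu>' s"
    by (simp add: eq_at_def)
  then have "eq_below \<mu>' s"
    using eq_belowI[of s \<mu>'] below' by (simp add: meet_at_def)
  moreover have "sigma_ge \<gamma> \<mu>' s" if \<gamma>: "\<gamma> \<in> {\<alpha>, \<beta>}" for \<gamma>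
  proof -
    have "E \<gamma>" if "\<forall>r\<in>moves G s. same \<gamma> \<mu>' r"
      using that same' unfolding E_def by (blast intro: same_trans same_sym)
    moreover have "bids_ge (bids \<gamma> s B) (bids \<mu>' s B)" if "E \<gamma>" "B \<in> budgets \<epsilon>" for B
      using x[OF that(2)] that(1) \<gamma> by (auto simp: N_def bids')
    moreover have "sigma_ge \<gamma> \<mu>' r" if "r \<in> moves G s" for r
      using below'[OF that] \<gamma> by (auto simp: meet_at_def)
    ultimately show ?thesis
      by (auto simp: sigma_ge_position[OF s])
  qed
  moreover have "sigma_ge \<mu>' \<delta> s"
    if \<delta>: "\<delta> \<in> PSPE G \<epsilon>" "sigma_ge \<alpha> \<delta> s" "sigma_ge \<beta> \<delta> s" for \<delta>
  proof -
    have "sigma_ge \<mu>' \<delta> r" if "r \<in> moves G s" for r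
      using below'[OF that] \<delta> sigma_ge_move[OF _ s that] by (auto simp: meet_at_def)
    moreover have "bids_ge (bids \<mu>' s B) (bids \<delta> s B)"
      if all: "\<forall>r\<in>moves G s. same \<mu>' \<delta> r" and B: "B \<in> budgets \<epsilon>" for B
    proof -
      have E: "E \<delta>"
        using all same' unfolding E_def by (blast intro: same_trans same_sym)
      \<comment> \<open>Where \<open>\<gamma>\<close> and \<open>\<delta>\<close> both agree with
        the meet below \<open>s\<close>, they agree with each other, so their bids at
        \<open>s\<close> are comparable. This puts the actions of \<open>\<delta>\<close> into
        \<open>N B\<close>, and the maximality of \<open>x B\<close> applies.\<close>
      have "bids_ge (bids \<gamma> s B) (bids \<delta> s B)" if \<gamma>: "\<gamma> \<in> {\<alpha>, \<beta>}" "E \<gamma>" for \<gamma>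
      proof (rule sigma_ge_bids[OF _ s _ B])
        show "sigma_ge \<gamma> \<delta> s" using \<gamma>(1) \<delta> by blast
        show "same \<gamma> \<delta> r" if "r \<in> moves G s" for r
          using that E \<gamma>(2) unfolding E_def by (blast intro: same_trans same_sym)
      qed
      then have "(\<lambda>i. \<delta> i s B) \<in> N B"
        using transfer[OF \<delta>(1) E B] by (auto simp: N_def bids_bid_pair)
      from x_max[OF B this] show ?thesis by (simp add: bids' bids_bid_pair[of \<delta>])
    qed
    ultimately show ?thesis
      by (auto simp: sigma_ge_position[OF s])
  qed
  ultimately have "meet_at \<alpha> \<beta> \<mu>' s"
    by (simp add: meet_at_def)
  then show ?thesis
    by (intro exI[of _ "\<lambda>i B. x B i"]) (simp add: \<mu>'_def)
qed

text \<open>Recursion from the terminals, extending at each position by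
  \<open>meet_at_extend\<close>. All states are treated at once, reachable or not, because
  \<open>PSPE\<close> demands equilibrium at every position.\<close>

lemma meet_exists:
  assumes \<alpha>: "\<alpha> \<in> PSPE G \<epsilon>" and \<beta>: "\<beta> \<in> PSPE G \<epsilon>"
  shows "\<exists>\<mu>\<in>PSPE G \<epsilon>. \<forall>s\<in>states G. meet_at \<alpha> \<beta> \<mu> s"
proof -
  \<comment> \<open>Cutting off all values outside the subgame at \<open>s\<close> makes the predicate for dependent choice
    local, also where the chosen strategies are not known to be valid.\<close>
  define cut :: "('s \<Rightarrow> player \<Rightarrow> real \<Rightarrow> real \<times> 's) \<Rightarrow> 's \<Rightarrow> (player \<Rightarrow> real \<Rightarrow> real \<times> 's) \<Rightarrow> 's profile"
    where "cut f s x = (\<lambda>i r. if r = s then x i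
      else if (s, r) \<in> (edges G)\<^sup>+ then f r i else undefined)"
    for f s x
  have terminal: "meet_at \<alpha> \<beta> \<mu> s" if "s \<notin> positions G" for \<mu> s
    using that eq_belowI[of s \<mu>] by (simp add: meet_at_def same_sigma_ge same_not_position)
  have "\<exists>f. \<forall>s. s \<in> positions G \<longrightarrow> meet_at \<alpha> \<beta> (cut f s (f s)) s"
  proof (rule dependent_wf_choice[OF wf_descendants])
    fix f g :: "'s \<Rightarrow> player \<Rightarrow> real \<Rightarrow> real \<times> 's" and s x
    assume "\<And>r. (r, s) \<in> ((edges G)\<^sup>+)\<inverse> \<Longrightarrow> f r = g r"
    then have "cut f s x = cut g s x" by (auto simp: cut_def fun_eq_iff)
    then show "(s \<in> positions G \<longrightarrow> meet_at \<alpha> \<beta> (cut f s x) s) =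
      (s \<in> positions G \<longrightarrow> meet_at \<alpha> \<beta> (cut g s x) s)" by simp
  next
    fix f :: "'s \<Rightarrow> player \<Rightarrow> real \<Rightarrow> real \<times> 's" and s
    assume IH: "\<And>r. (r, s) \<in> ((edges G)\<^sup>+)\<inverse> \<Longrightarrow> r \<in> positions G \<longrightarrow> meet_at \<alpha> \<beta> (cut f r (f r)) r"
    show "\<exists>x. s \<in> positions G \<longrightarrow> meet_at \<alpha> \<beta> (cut f s x) s"
    proof (cases "s \<in> positions G")
      case s: True
      \<comment> \<open>The value \<open>undefined\<close> at \<open>s\<close> is a placeholder: the
        successors' subgames do not contain \<open>s\<close>, and the extension overwrites
        it.\<close>
      have "meet_at \<alpha> \<beta> (cut f s undefined) r" if r: "r \<in> moves G s" for r
      proof (cases "r \<in> positions G")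
        case True
        have sr: "(s, r) \<in> edges G" using s r by (simp add: edges_iff)
        show ?thesis
        proof (rule meet_at_cong)
          show "meet_at \<alpha> \<beta> (cut f r (f r)) r" using IH sr True by blast
          show "r \<in> states G" using True by (rule positions_subset)
          fix q assume q: "(r, q) \<in> (edges G)\<^sup>*"
          then have "q \<noteq> s" "(s, q) \<in> (edges G)\<^sup>+" "q = r \<or> (r, q) \<in> (edges G)\<^sup>+"
            using not_reachable_from_move[OF s r] sr
            by (auto dest: rtranclD intro: rtrancl_into_trancl2)
          then show "\<forall>i. cut f r (f r) i q = cut f s undefined i q"
            by (auto simp: cut_def)
        qed
      qed (rule terminal)
      then obtain x where "meet_at \<alpha> \<beta> (\<lambda>i. (cut f s undefined i)(s := x i)) s"
        using meet_at_extend[OF s \<alpha> \<beta>] by blast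
      moreover have "(\<lambda>i. (cut f s undefined i)(s := x i)) = cut f s x"
        by (auto simp: cut_def fun_eq_iff)
      ultimately show ?thesis by auto
    qed simp
  qed
  then obtain f where f: "\<And>s. s \<in> positions G \<Longrightarrow> meet_at \<alpha> \<beta> (cut f s (f s)) s" by blast
  define \<mu> where "\<mu> = (\<lambda>i s. f s i)"
  have meet: "meet_at \<alpha> \<beta> \<mu> s" for s
  proof (cases "s \<in> positions G")
    case True
    show ?thesis
    proof (rule meet_at_cong[OF f[OF True] positions_subset[OF True]])
      fix r assume "(s, r) \<in> (edges G)\<^sup>*"
      then show "\<forall>i. cut f s (f s) i r = \<mu> i r"
        by (auto simp: cut_def \<mu>_def dest: rtranclD)
    qed
  qed (rule terminal)
  then have "\<mu> \<in> PSPE G \<epsilon>"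
    by (intro eq_at_PSPE) (auto simp: meet_at_def intro: eq_below_eq_at)
  with meet show ?thesis by blast
qed

section \<open>The quotient\<close>

lemma pi_ge_iff: "pi_ge G \<epsilon> \<alpha> \<beta> \<longleftrightarrow> sigma_ge \<alpha> \<beta> (start G)"
  by (simp add: pi_ge_def pi_gt_def pi_eq_def sigma_ge_def)

lemma same_bids_iff:
  "(\<alpha>, \<beta>) \<in> same_bids G \<epsilon> \<longleftrightarrow> \<alpha> \<in> PSPE G \<epsilon> \<and> \<beta> \<in> PSPE G \<epsilon> \<and> same \<alpha> \<beta> (start G)"
  by (simp add: same_bids_def pi_eq_def)

lemma equiv_same_bids: "equiv (PSPE G \<epsilon>) (same_bids G \<epsilon>)"
  by (intro equivI refl_onI symI transI)
    (auto simp: same_bids_iff intro: same_sym same_trans)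

abbreviation cls :: "'s profile \<Rightarrow> 's profile set" where
  "cls \<alpha> \<equiv> same_bids G \<epsilon> `` {\<alpha>}"

lemma carrier_iff: "X \<in> carrier (PSPE_order G \<epsilon>) \<longleftrightarrow> (\<exists>\<alpha>\<in>PSPE G \<epsilon>. X = cls \<alpha>)"
  by (auto simp: PSPE_order_def quotient_def)

text \<open>The order on classes asks for some pair of representatives; transitivity together with
  \<open>same_sigma_ge\<close> carries the comparison to any other pair.\<close>

lemma le_cls:
  assumes "\<alpha> \<in> PSPE G \<epsilon>" "\<beta> \<in> PSPE G \<epsilon>"
  shows "le (PSPE_order G \<epsilon>) (cls \<alpha>) (cls \<beta>) \<longleftrightarrow> sigma_ge \<beta> \<alpha> (start G)"
proof
  assume "le (PSPE_order G \<epsilon>) (cls \<alpha>) (cls \<beta>)"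
  then obtain \<alpha>' \<beta>' where "same \<alpha> \<alpha>' (start G)" "same \<beta> \<beta>' (start G)"
    "sigma_ge \<beta>' \<alpha>' (start G)"
    by (auto simp: PSPE_order_def pi_ge_iff same_bids_iff)
  then show "sigma_ge \<beta> \<alpha> (start G)"
    using sigma_ge_trans[OF start_states] same_sigma_ge same_sym by blast
next
  assume "sigma_ge \<beta> \<alpha> (start G)"
  moreover have "\<alpha> \<in> cls \<alpha>" "\<beta> \<in> cls \<beta>"
    using assms by (simp_all add: same_bids_iff)
  ultimately show "le (PSPE_order G \<epsilon>) (cls \<alpha>) (cls \<beta>)"
    unfolding PSPE_order_def by (auto simp only: pi_ge_iff gorder.simps)
qed

lemma cls_eqI:
  "\<alpha> \<in> PSPE G \<epsilon> \<Longrightarrow> \<beta> \<in> PSPE G \<epsilon> \<Longrightarrow> same \<alpha> \<beta> (start G) \<Longrightarrow> cls \<alpha> = cls \<beta>"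
  by (intro equiv_class_eq[OF equiv_same_bids]) (simp add: same_bids_iff)

lemma partial_order_PSPE_order: "partial_order (PSPE_order G \<epsilon>)"
proof
  have eq: "eq (PSPE_order G \<epsilon>) = (=)" by (simp add: PSPE_order_def)
  then show "eq (PSPE_order G \<epsilon>) = (=)" .
  show "eq (PSPE_order G \<epsilon>) X X" for X using eq by simp
  show "eq (PSPE_order G \<epsilon>) X Y \<Longrightarrow> eq (PSPE_order G \<epsilon>) Y X" for X Y using eq by simp
  show "eq (PSPE_order G \<epsilon>) X Y \<Longrightarrow> eq (PSPE_order G \<epsilon>) Y Z \<Longrightarrow> eq (PSPE_order G \<epsilon>) X Z"
    for X Y Z using eq by simp
  show "eq (PSPE_order G \<epsilon>) X Y \<Longrightarrow> eq (PSPE_order G \<epsilon>) Z W \<Longrightarrow>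
    le (PSPE_order G \<epsilon>) X Z = le (PSPE_order G \<epsilon>) Y W" for X Y Z W using eq by simp
  fix X assume "X \<in> carrier (PSPE_order G \<epsilon>)"
  then obtain \<alpha> where \<alpha>: "\<alpha> \<in> PSPE G \<epsilon>" "X = cls \<alpha>" by (auto simp: carrier_iff)
  show "le (PSPE_order G \<epsilon>) X X" using \<alpha> by (simp add: le_cls same_sigma_ge)
  fix Y assume "Y \<in> carrier (PSPE_order G \<epsilon>)"
  then obtain \<beta> where \<beta>: "\<beta> \<in> PSPE G \<epsilon>" "Y = cls \<beta>" by (auto simp: carrier_iff)
  show "eq (PSPE_order G \<epsilon>) X Y" if "le (PSPE_order G \<epsilon>) X Y" "le (PSPE_order G \<epsilon>) Y X"
    using that \<alpha> \<beta> sigma_ge_antisym[OF start_states, of \<alpha> \<beta>] cls_eqI[of \<alpha> \<beta>]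
    by (simp add: le_cls eq)
  fix Z assume "Z \<in> carrier (PSPE_order G \<epsilon>)"
  then obtain \<gamma> where \<gamma>: "\<gamma> \<in> PSPE G \<epsilon>" "Z = cls \<gamma>" by (auto simp: carrier_iff)
  show "le (PSPE_order G \<epsilon>) X Z" if "le (PSPE_order G \<epsilon>) X Y" "le (PSPE_order G \<epsilon>) Y Z"
    using that \<alpha> \<beta> \<gamma> sigma_ge_trans[OF start_states, of \<gamma> \<beta> \<alpha>] by (simp add: le_cls)
qed

text \<open>Every class has a representative, so the instance of \<open>meet_at\<close> at
  \<open>start G\<close> carries over to classes through \<open>le_cls\<close>.\<close>

lemma lower_semilattice_PSPE_order: "lower_semilattice (PSPE_order G \<epsilon>)"
proof -
  interpret partial_order "PSPE_order G \<epsilon>" by (rule partial_order_PSPE_order)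
  show ?thesis
  proof
    fix X Y assume XY: "X \<in> carrier (PSPE_order G \<epsilon>)" "Y \<in> carrier (PSPE_order G \<epsilon>)"
    then obtain \<alpha> \<beta> where \<alpha>: "\<alpha> \<in> PSPE G \<epsilon>" "X = cls \<alpha>" and \<beta>: "\<beta> \<in> PSPE G \<epsilon>" "Y = cls \<beta>"
      by (auto simp: carrier_iff)
    then obtain \<mu> where \<mu>: "\<mu> \<in> PSPE G \<epsilon>" "meet_at \<alpha> \<beta> \<mu> (start G)"
      using meet_exists start_states by blast
    have "greatest (PSPE_order G \<epsilon>) (cls \<mu>) (Lower (PSPE_order G \<epsilon>) {X, Y})"
    proof (rule greatest_LowerI)
      show "le (PSPE_order G \<epsilon>) (cls \<mu>) Z" if "Z \<in> {X, Y}" for Z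
        using that \<alpha> \<beta> \<mu> by (auto simp: le_cls meet_at_def)
      show "{X, Y} \<subseteq> carrier (PSPE_order G \<epsilon>)" using XY by simp
      show "cls \<mu> \<in> carrier (PSPE_order G \<epsilon>)" using \<mu> by (auto simp: carrier_iff)
      fix Z assume Z: "Z \<in> Lower (PSPE_order G \<epsilon>) {X, Y}"
      then obtain \<delta> where \<delta>: "\<delta> \<in> PSPE G \<epsilon>" "Z = cls \<delta>" by (auto simp: Lower_def carrier_iff)
      have "le (PSPE_order G \<epsilon>) Z X" "le (PSPE_order G \<epsilon>) Z Y"
        using Z XY by (auto simp: Lower_def)
      then show "le (PSPE_order G \<epsilon>) Z (cls \<mu>)"
        using \<alpha> \<beta> \<delta> \<mu> by (simp add: le_cls meet_at_def)
    qed
    then show "\<exists>Z. greatest (PSPE_order G \<epsilon>) Z (Lower (PSPE_order G \<epsilon>) {X, Y})" by blast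
  qed
qed

end

theorem theorem5:
  fixes G :: "'s game" and \<epsilon> :: real
  assumes "bidding_game G \<epsilon>"
  shows "lower_semilattice (PSPE_order G \<epsilon>)"
proof -
  interpret bidding G \<epsilon> by (rule bidding.intro[OF assms])
  show ?thesis by (rule lower_semilattice_PSPE_order)
qed

end
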